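(* Let $p\in[1,2)$, let $P=-\partial_\psi R$ be the $(p-1)$-homogeneous operator on $\mathbb{R}^M$ described in the context, and let $f\in\mathbb{R}^M$, $f\neq 0$, satisfy $P(f)=\lambda f$ with $\lambda<0$. Let $\psi(t)=a(t)f$, $a(t)=\left[(1+(2-p)\lambda t)^+\right]^{\frac{1}{2-p}}$, be the solution of $\psi_t=P(\psi)$, $\psi(0)=f$, with extinction time $T_{ext}=-\frac{1}{\lambda(2-p)}$. Sample the solution uniformly on $[0,T_{ext}]$: $\psi_k=\psi(k\,dt)$, $k=0,\dots,N$, $dt=T_{ext}/N$, and apply DMD to $\{\psi_k\}_{k=0}^N$. Then: 1. If $r=1$ and $N\to\infty$, then $ERR_{DMD}\to 0$. However, the reconstruction error $ERR^c_{Rec}$ of the ($N\to\infty$) time-continuous DMD reconstruction satisfies $ERR^c_{Rec}\ge B$, where $$B=-\|f\|^2\frac{1}{\lambda(4-p)}\left[1-\sqrt{1-e^{-\frac{4-p}{2-p}}}\right]^2>0 .$$ 2. One cannot reduce $ERR^c_{Rec}$ by increasing the dimensionality to $r>1$, in the sense that for $r>1$ the DMD solution does not exist.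
   Context: Setting. $\mathbb{R}^M$ carries the Euclidean norm. $R:\mathbb{R}^M\to\mathbb{R}^+$ is absolutely $p$-homogeneous, $R(c\psi)=|c|^pR(\psi)$ for $c\in\mathbb{R}$, and $P=-\partial_\psi R$ is $(p-1)$-homogeneous, $P(c\psi)=c|c|^{p-2}P(\psi)$; $-P$ is maximally monotone. It is known that if $P(f)=\lambda f$ then the solution of $\psi_t=P(\psi)$, $\psi(0)=f$, is $\psi(t)=a(t)f$ with $a(t)$ as in the claim, where $(x)^+=\max\{0,x\}$. DMD (Dynamic Mode Decomposition) of dimensionality $r$ for data $\psi_0,\dots,\psi_N\in\mathbb{R}^M$. Put $\Psi_0^{N-1}=[\psi_0\ \cdots\ \psi_{N-1}]$, $\Psi_1^N=[\psi_1\ \cdots\ \psi_N]$. Take a singular value decomposition $\Psi_0^{N-1}=U\Sigma V^*$ with singular values in decreasing order and let $U_r$ be the first $r$ columns of $U$. Set $X=U_r^*\Psi_0^{N-1}$, $Y=U_r^*\Psi_1^N$. The DMD matrix is $F=YX^T(XX^T)^{-1}$; the DMD solution exists when $XX^T$ is invertible, and $F$ then is the minimizer in $$ERR_{DMD}=\min_F\|Y-FX\|_{\mathcal F}^2\quad(\text{Frobenius norm}).$$ Let $\mu_i$, $w_i$ ($i=1,\dots,r$) be the eigenvalues and (normalized) right eigenvectors of $F$; the modes are $\phi_i=U_rw_i$ and the coordinates are $\alpha_i=w_i^*U_r^*\psi_0$. Time-continuous reconstruction and error. For sampling step $dt$ put $\tilde\mu_i=\ln(\mu_i)/dt$; in the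 limit case $dt\to0$ ($N\to\infty$) $\tilde\mu_i$ denotes the limit of this quotient. The time-continuous reconstruction is $\tilde\psi(t)=\sum_{i=1}^r\alpha_i\phi_ie^{\tilde\mu_it}$, and $$ERR^c_{Rec}=\int_0^{T_{ext}}\|\tilde\psi(t)-\psi(t)\|^2\,dt .$$ *)

theory Defs
  imports
    "HOL-Analysis.Analysis"
    "Jordan_Normal_Form.Schur_Decomposition"
    "Jordan_Normal_Form.Gauss_Jordan_Elimination"
begin

unbundle no vec_syntax
unbundle no inner_syntax

text \<open>
  The space of dimension M is \<^term>\<open>carrier_vec M\<close>, with M a natural number: the number of
  snapshots and the rank parameter vary, so dimensions cannot be types.
\<close>

definition vec_norm :: "'a::real_normed_vector vec \<Rightarrow> real" where
  "vec_norm v = L2_set (\<lambda>i. norm (v $ i)) {..<dim_vec v}"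

definition frobenius_norm :: "real mat \<Rightarrow> real" where
  "frobenius_norm A = sqrt (\<Sum>i<dim_row A. \<Sum>j<dim_col A. (A $$ (i, j))\<^sup>2)"

definition abs_homogeneous :: "nat \<Rightarrow> real \<Rightarrow> (real vec \<Rightarrow> real) \<Rightarrow> bool" where
  "abs_homogeneous M p R \<longleftrightarrow>
     (\<forall>v\<in>carrier_vec M. \<forall>c. R (c \<cdot>\<^sub>v v) = \<bar>c\<bar> powr p * R v)"

definition subdifferential :: "nat \<Rightarrow> (real vec \<Rightarrow> real) \<Rightarrow> real vec \<Rightarrow> real vec set" where
  "subdifferential M R x =
     {g \<in> carrier_vec M. \<forall>y\<in>carrier_vec M. R x + g \<bullet> (y - x) \<le> R y}"

text \<open>
  Operators are set-valued, since for p = 1 a functional R with a nonzero subgradient somewhere is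
  not differentiable at 0. In the differentiable case all the sets below are singletons.
  The scalar c = 0 is left out in the homogeneity law, whose factor is undefined there.
\<close>

definition homogeneous_operator :: "nat \<Rightarrow> real \<Rightarrow> (real vec \<Rightarrow> real vec set) \<Rightarrow> bool" where
  "homogeneous_operator M p P \<longleftrightarrow>
     (\<forall>v\<in>carrier_vec M. \<forall>c. c \<noteq> 0 \<longrightarrow>
        P (c \<cdot>\<^sub>v v) = (\<lambda>u. (c * \<bar>c\<bar> powr (p - 2)) \<cdot>\<^sub>v u) ` P v)"

definition monotone_operator :: "nat \<Rightarrow> (real vec \<Rightarrow> real vec set) \<Rightarrow> bool" where
  "monotone_operator M A \<longleftrightarrow>
     (\<forall>x\<in>carrier_vec M. A x \<subseteq> carrier_vec M) \<and>
     (\<forall>x\<in>carrier_vec M. \<forall>y\<in>carrier_vec M. \<forall>u\<in>A x. \<forall>v\<in>A y. 0 \<le> (x - y) \<bullet> (u - v))"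

definition maximally_monotone :: "nat \<Rightarrow> (real vec \<Rightarrow> real vec set) \<Rightarrow> bool" where
  "maximally_monotone M A \<longleftrightarrow>
     monotone_operator M A \<and>
     (\<forall>x\<in>carrier_vec M. \<forall>u\<in>carrier_vec M.
        (\<forall>y\<in>carrier_vec M. \<forall>v\<in>A y. 0 \<le> (x - y) \<bullet> (u - v)) \<longrightarrow> u \<in> A x)"

text \<open>
  Solutions of the evolution inclusion are continuous and satisfy it at every time t with the right
  derivative. Two-sided derivatives need not exist: for p = 1 the solution has a corner at its
  extinction time.
\<close>

definition flow_solution ::
  "nat \<Rightarrow> (real vec \<Rightarrow> real vec set) \<Rightarrow> real vec \<Rightarrow> (real \<Rightarrow> real vec) \<Rightarrow> bool" where
  "flow_solution M P f \<psi> \<longleftrightarrow>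
     (\<forall>t\<ge>0. \<psi> t \<in> carrier_vec M) \<and> \<psi> 0 = f \<and>
     (\<forall>i<M. continuous_on {0..} (\<lambda>t. \<psi> t $ i)) \<and>
     (\<forall>t\<ge>0. \<exists>v\<in>P (\<psi> t). \<forall>i<M.
        ((\<lambda>s. \<psi> s $ i) has_real_derivative v $ i) (at t within {t..}))"

definition decay_profile :: "real \<Rightarrow> real \<Rightarrow> real \<Rightarrow> real" where
  "decay_profile p lam t = (max 0 (1 + (2 - p) * lam * t)) powr (1 / (2 - p))"

definition extinction_time :: "real \<Rightarrow> real \<Rightarrow> real" where
  "extinction_time p lam = - 1 / (lam * (2 - p))"

definition is_svd :: "real mat \<Rightarrow> real mat \<Rightarrow> real mat \<Rightarrow> real mat \<Rightarrow> bool" where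
  "is_svd A U S V \<longleftrightarrow>
     (let m = dim_row A; n = dim_col A in
      U \<in> carrier_mat m m \<and> S \<in> carrier_mat m n \<and> V \<in> carrier_mat n n \<and>
      mat_adjoint U * U = 1\<^sub>m m \<and> mat_adjoint V * V = 1\<^sub>m n \<and>
      diagonal_mat S \<and>
      (\<forall>i<min m n. 0 \<le> S $$ (i, i)) \<and>
      (\<forall>i j. i \<le> j \<and> j < min m n \<longrightarrow> S $$ (j, j) \<le> S $$ (i, i)) \<and>
      A = U * S * mat_adjoint V)"

definition leading_cols :: "nat \<Rightarrow> 'a mat \<Rightarrow> 'a mat" where
  "leading_cols r U = mat_of_cols (dim_row U) (take r (cols U))"

definition past_snapshots :: "nat \<Rightarrow> nat \<Rightarrow> (nat \<Rightarrow> real vec) \<Rightarrow> real mat" where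
  "past_snapshots M N \<psi>s = mat_of_cols M (map \<psi>s [0..<N])"

definition next_snapshots :: "nat \<Rightarrow> nat \<Rightarrow> (nat \<Rightarrow> real vec) \<Rightarrow> real mat" where
  "next_snapshots M N \<psi>s = mat_of_cols M (map \<psi>s [1..<Suc N])"

definition dmd_X :: "nat \<Rightarrow> nat \<Rightarrow> nat \<Rightarrow> (nat \<Rightarrow> real vec) \<Rightarrow> real mat \<Rightarrow> real mat" where
  "dmd_X M N r \<psi>s U = mat_adjoint (leading_cols r U) * past_snapshots M N \<psi>s"

definition dmd_Y :: "nat \<Rightarrow> nat \<Rightarrow> nat \<Rightarrow> (nat \<Rightarrow> real vec) \<Rightarrow> real mat \<Rightarrow> real mat" where
  "dmd_Y M N r \<psi>s U = mat_adjoint (leading_cols r U) * next_snapshots M N \<psi>s"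

text \<open>The first r columns of U exist only for r at most M.\<close>

definition dmd_exists :: "nat \<Rightarrow> nat \<Rightarrow> nat \<Rightarrow> (nat \<Rightarrow> real vec) \<Rightarrow> real mat \<Rightarrow> bool" where
  "dmd_exists M N r \<psi>s U \<longleftrightarrow>
     r \<le> M \<and> invertible_mat (dmd_X M N r \<psi>s U * transpose_mat (dmd_X M N r \<psi>s U))"

definition dmd_matrix :: "nat \<Rightarrow> nat \<Rightarrow> nat \<Rightarrow> (nat \<Rightarrow> real vec) \<Rightarrow> real mat \<Rightarrow> real mat" where
  "dmd_matrix M N r \<psi>s U =
     (let X = dmd_X M N r \<psi>s U; Y = dmd_Y M N r \<psi>s U in
      Y * transpose_mat X * the (mat_inverse (X * transpose_mat X)))"

definition dmd_error :: "nat \<Rightarrow> nat \<Rightarrow> nat \<Rightarrow> (nat \<Rightarrow> real vec) \<Rightarrow> real mat \<Rightarrow> real" where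
  "dmd_error M N r \<psi>s U =
     (INF F\<in>carrier_mat r r.
        (frobenius_norm (dmd_Y M N r \<psi>s U - F * dmd_X M N r \<psi>s U))\<^sup>2)"

text \<open>Eigenvalues are listed with algebraic multiplicity; those of a real matrix may be complex.\<close>

definition eigensystem ::
  "nat \<Rightarrow> real mat \<Rightarrow> (nat \<Rightarrow> complex) \<Rightarrow> (nat \<Rightarrow> complex vec) \<Rightarrow> bool" where
  "eigensystem r F \<mu> w \<longleftrightarrow>
     char_poly (map_mat complex_of_real F) = (\<Prod>i<r. [:- \<mu> i, 1:]) \<and>
     (\<forall>i<r. eigenvector (map_mat complex_of_real F) (w i) (\<mu> i) \<and> vec_norm (w i) = 1)"

definition dmd_mode :: "nat \<Rightarrow> real mat \<Rightarrow> complex vec \<Rightarrow> complex vec" where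
  "dmd_mode r U w = map_mat complex_of_real (leading_cols r U) *\<^sub>v w"

definition dmd_coordinate :: "nat \<Rightarrow> real mat \<Rightarrow> real vec \<Rightarrow> complex vec \<Rightarrow> complex" where
  "dmd_coordinate r U \<psi>0 w =
     map_vec complex_of_real (mat_adjoint (leading_cols r U) *\<^sub>v \<psi>0) \<bullet>c w"

definition dmd_reconstruction ::
  "nat \<Rightarrow> nat \<Rightarrow> real mat \<Rightarrow> real vec \<Rightarrow> (nat \<Rightarrow> complex vec) \<Rightarrow> (nat \<Rightarrow> complex) \<Rightarrow>
     real \<Rightarrow> complex vec" where
  "dmd_reconstruction M r U \<psi>0 w \<mu>t t =
     vec M (\<lambda>j. \<Sum>i<r. dmd_coordinate r U \<psi>0 (w i) * dmd_mode r U (w i) $ j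
                       * exp (\<mu>t i * of_real t))"

text \<open>
  The reconstruction in the limit of infinitely many samples. The N-th member of each sequence
  comes from the N-th DMD; \<^term>\<open>\<mu>t\<close> collects the limits of the rates. Coordinates and modes
  separately depend on the choice of U and w, hence the limit is taken of the whole sum.
\<close>

definition dmd_limit_reconstruction ::
  "nat \<Rightarrow> nat \<Rightarrow> (nat \<Rightarrow> real) \<Rightarrow> (nat \<Rightarrow> real mat) \<Rightarrow> real vec \<Rightarrow> (nat \<Rightarrow> nat \<Rightarrow> complex vec) \<Rightarrow>
     (nat \<Rightarrow> nat \<Rightarrow> complex) \<Rightarrow> (real \<Rightarrow> complex vec) \<Rightarrow> bool" where
  "dmd_limit_reconstruction M r dt U \<psi>0 w \<mu> \<psi>r \<longleftrightarrow>
     (\<exists>\<mu>t. (\<forall>i<r. (\<lambda>N. Ln (\<mu> N i) / of_real (dt N)) \<longlonglongrightarrow> \<mu>t i) \<and>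
        (\<forall>t. \<psi>r t \<in> carrier_vec M \<and>
           (\<forall>j<M. (\<lambda>N. dmd_reconstruction M r (U N) \<psi>0 (w N) \<mu>t t $ j) \<longlonglongrightarrow> \<psi>r t $ j)))"

definition reconstruction_error ::
  "real \<Rightarrow> (real \<Rightarrow> complex vec) \<Rightarrow> (real \<Rightarrow> real vec) \<Rightarrow> real" where
  "reconstruction_error T \<psi>r \<psi> =
     integral {0..T} (\<lambda>t. (vec_norm (\<psi>r t - map_vec complex_of_real (\<psi> t)))\<^sup>2)"

definition sampling_step :: "real \<Rightarrow> real \<Rightarrow> nat \<Rightarrow> real" where
  "sampling_step p lam N = extinction_time p lam / real N"

definition samples :: "real \<Rightarrow> real \<Rightarrow> (real \<Rightarrow> real vec) \<Rightarrow> nat \<Rightarrow> nat \<Rightarrow> real vec" where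
  "samples p lam \<psi> N k = \<psi> (real k * sampling_step p lam N)"

definition error_bound :: "real \<Rightarrow> real \<Rightarrow> real vec \<Rightarrow> real" where
  "error_bound p lam f =
     - (vec_norm f)\<^sup>2 * (1 / (lam * (4 - p))) * (1 - sqrt (1 - exp (- ((4 - p) / (2 - p)))))\<^sup>2"

end

theory Submission
  imports Defs
begin

text \<open>
  All samples are multiples \<open>a\<^sub>k f\<close> with \<open>a\<^sub>k = (1 - k/N)\<^sup>q\<close>, \<open>q = 1/(2 - p)\<close>, so the data matrix has
  rank one: its first left singular vector is \<open>f\<close> normalized, up to sign, and all others are
  orthogonal to \<open>f\<close>. Hence the Gram matrix is singular for \<open>r > 1\<close>, while for \<open>r = 1\<close> the DMD matrix
  is the number \<open>\<mu> = \<Sum> a\<^sub>k a\<^bsub>k+1\<^esub> / \<Sum> a\<^sub>k\<^sup>2\<close> and the reconstruction is \<open>f\<close> times an exponential.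
  Since \<open>N (\<mu> - 1)\<close> tends to \<open>-(2q + 1)/2\<close>, the limiting rate is \<open>\<lambda>(4 - p)/2\<close>. The bound is then
  the reverse triangle inequality in \<open>L\<^sup>2[0, T]\<close> for this exponential and the exact profile, whose
  norms are explicit.
\<close>

section \<open>DMD of rank-one data\<close>

lemma mat_adjoint_real: "mat_adjoint (A :: real mat) = transpose_mat A"
  by (rule eq_matI) (auto simp: mat_adjoint_def mat_of_rows_def)

lemma vec_norm_square: "(vec_norm v)\<^sup>2 = (\<Sum>i<dim_vec v. (norm (v $ i))\<^sup>2)"
  by (simp add: vec_norm_def L2_set_def sum_nonneg)

text \<open>The coefficients \<open>c\<close> stay abstract. Together with \<open>N\<close> and
  \<open>f_nz\<close>, \<open>c0\<close> ensures that the data matrix is not zero.\<close>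

locale rank_one_dmd =
  fixes M N :: nat and f :: "real vec" and c :: "nat \<Rightarrow> real" and U S V :: "real mat"
  assumes N: "1 \<le> N" and f: "f \<in> carrier_vec M" and f_nz: "f \<noteq> 0\<^sub>v M" and c0: "c 0 \<noteq> 0"
    and svd: "is_svd (past_snapshots M N (\<lambda>k. c k \<cdot>\<^sub>v f)) U S V"
begin

abbreviation "data \<equiv> \<lambda>k. c k \<cdot>\<^sub>v f"

text \<open>Coordinate of \<open>f\<close> along the i-th left singular vector. All projected data
  are expressed through these numbers.\<close>

definition proj :: "nat \<Rightarrow> real" where
  "proj i = (\<Sum>k<M. U $$ (k, i) * f $ k)"

section \<open>Singular vectors of the rank-one data matrix\<close>

lemma past: "past_snapshots M N data = mat M N (\<lambda>(i, j). c j * f $ i)"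
  using f by (intro eq_matI) (auto simp: past_snapshots_def mat_of_cols_def)

lemma nexts: "next_snapshots M N data = mat M N (\<lambda>(i, j). c (Suc j) * f $ i)"
  using f by (intro eq_matI) (auto simp: next_snapshots_def mat_of_cols_def simp del: upt_Suc)

lemma M: "1 \<le> M"
  using f f_nz by (cases M) auto

lemma U: "U \<in> carrier_mat M M" and S: "S \<in> carrier_mat M N" and V: "V \<in> carrier_mat N N"
  and UU: "transpose_mat U * U = 1\<^sub>m M" and VV: "transpose_mat V * V = 1\<^sub>m N"
  and diag: "diagonal_mat S" and S_decr: "\<And>i. i < min M N \<Longrightarrow> 0 \<le> S $$ (i, i) \<and> S $$ (i, i) \<le> S $$ (0, 0)"
  and decomp: "past_snapshots M N data = U * S * transpose_mat V"
  using svd by (auto simp: is_svd_def Let_def past mat_adjoint_real)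

lemma UU': "U * transpose_mat U = 1\<^sub>m M"
  by (rule mat_mult_left_right_inverse[OF _ U UU]) (use U in auto)

lemma U_cols: "i < M \<Longrightarrow> j < M \<Longrightarrow> (\<Sum>k<M. U $$ (k, i) * U $$ (k, j)) = (if i = j then 1 else 0)"
  using arg_cong[OF UU, of "\<lambda>A. A $$ (i, j)"] U
  by (simp add: scalar_prod_def atLeast0LessThan)

lemma U_rows: "i < M \<Longrightarrow> j < M \<Longrightarrow> (\<Sum>k<M. U $$ (i, k) * U $$ (j, k)) = (if i = j then 1 else 0)"
  using arg_cong[OF UU', of "\<lambda>A. A $$ (i, j)"] U
  by (simp add: scalar_prod_def atLeast0LessThan)

lemma V_cols: "i < N \<Longrightarrow> j < N \<Longrightarrow> (\<Sum>k<N. V $$ (k, i) * V $$ (k, j)) = (if i = j then 1 else 0)"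
  using arg_cong[OF VV, of "\<lambda>A. A $$ (i, j)"] V
  by (simp add: scalar_prod_def atLeast0LessThan)

lemma sum_c_pos: "0 < (\<Sum>k<N. (c k)\<^sup>2)"
  using N c0 by (intro sum_pos2[of _ 0]) auto

text \<open>Multiplying the decomposition by the transpose of \<open>U\<close> gives S V^T on one
  side, while the rank-one form gives \<open>proj i * c j\<close> on the other. For
  \<open>N \<le> i\<close> row i of \<open>S\<close> has no diagonal entry and vanishes.\<close>

lemma proj_times_c:
  assumes "i < M" and "j < N"
  shows "proj i * c j = (if i < N then S $$ (i, i) * V $$ (j, i) else 0)"
proof -
  have "transpose_mat U * past_snapshots M N data = (transpose_mat U * U) * (S * transpose_mat V)"
    unfolding decomp using U S V by (simp add: assoc_mult_mat[of _ M M _ M _ N] assoc_mult_mat[of _ M M _ N _ N])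
  also have "\<dots> = S * transpose_mat V"
    unfolding UU using S V by auto
  finally have "(transpose_mat U * past_snapshots M N data) $$ (i, j) = (S * transpose_mat V) $$ (i, j)"
    by simp
  moreover have "(transpose_mat U * past_snapshots M N data) $$ (i, j) = proj i * c j"
    using assms U
    by (simp add: past scalar_prod_def atLeast0LessThan proj_def sum_distrib_left mult_ac)
  moreover have "(S * transpose_mat V) $$ (i, j) = (\<Sum>l<N. if l = i then S $$ (i, i) * V $$ (j, i) else 0)"
  proof -
    have "(S * transpose_mat V) $$ (i, j) = (\<Sum>l<N. S $$ (i, l) * V $$ (j, l))"
      using assms S V by (simp add: scalar_prod_def atLeast0LessThan)
    also have "\<dots> = (\<Sum>l<N. if l = i then S $$ (i, i) * V $$ (j, i) else 0)"
      using assms S diag by (intro sum.cong) (auto simp: diagonal_mat_def)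
    finally show ?thesis .
  qed
  ultimately show ?thesis
    by simp
qed

lemma f_expand: "k < M \<Longrightarrow> f $ k = (\<Sum>i<M. proj i * U $$ (k, i))"
proof -
  assume k: "k < M"
  have "(\<Sum>i<M. proj i * U $$ (k, i)) = (\<Sum>l<M. (\<Sum>i<M. U $$ (l, i) * U $$ (k, i)) * f $ l)"
    unfolding proj_def sum_distrib_right
    by (subst sum.swap) (auto intro!: sum.cong)
  also have "\<dots> = (\<Sum>l<M. if l = k then f $ l else 0)"
    using k by (intro sum.cong) (auto simp: U_rows)
  also have "\<dots> = f $ k"
    using k by simp
  finally show ?thesis by simp
qed

text \<open>The singular values are in decreasing order, so a vanishing first one forces all to
  vanish; then every coordinate of \<open>f\<close> is zero.\<close>

lemma S0: "S $$ (0, 0) \<noteq> 0"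
proof
  assume 0: "S $$ (0, 0) = 0"
  have "proj i = 0" if "i < M" for i
    using proj_times_c[of i 0] S_decr[of i] that N c0 0 by (auto split: if_splits)
  then have "f = 0\<^sub>v M"
    using f f_expand by (intro eq_vecI) auto
  with f_nz show False by simp
qed

text \<open>Rows i and 0 of the rotated data are multiples of the orthogonal columns i and 0 of
  \<open>V\<close>, yet both are also multiples of the same nonzero vector \<open>c\<close>. Hence
  one of them is zero, and it is not row 0.\<close>

lemma proj_eq_0:
  assumes "0 < i" and "i < M"
  shows "proj i = 0"
proof (cases "i < N")
  case False
  then show ?thesis using proj_times_c[of i 0] assms N c0 by simp
next
  case True
  \<comment> \<open>Otherwise, the first singular value being nonzero, column 0 of \<open>V\<close>
    would vanish, although it has length 1.\<close>
  have p0: "proj 0 \<noteq> 0"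
  proof
    assume "proj 0 = 0"
    then have "V $$ (j, 0) = 0" if "j < N" for j
      using proj_times_c[of 0 j] S0 that N M by auto
    then show False using V_cols[of 0 0] N by simp
  qed
  have "(\<Sum>j<N. (proj i * c j) * (proj 0 * c j)) = S $$ (i, i) * S $$ (0, 0) * (\<Sum>j<N. V $$ (j, i) * V $$ (j, 0))"
    unfolding sum_distrib_left using assms True N
    by (intro sum.cong) (auto simp: proj_times_c)
  also have "\<dots> = 0"
    using V_cols[of i 0] assms True by simp
  finally have "proj i * proj 0 * (\<Sum>j<N. (c j)\<^sup>2) = 0"
    by (simp add: sum_distrib_left power2_eq_square mult_ac)
  then show ?thesis using p0 sum_c_pos by simp
qed

lemma f_eq: "k < M \<Longrightarrow> f $ k = proj 0 * U $$ (k, 0)"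
proof -
  assume k: "k < M"
  have "(\<Sum>i<M. proj i * U $$ (k, i)) = (\<Sum>i<M. if i = 0 then proj 0 * U $$ (k, 0) else 0)"
    by (intro sum.cong) (auto simp: proj_eq_0)
  then show ?thesis using f_expand[OF k] M by simp
qed

text \<open>The decomposition determines the first singular vector only up to sign, so only the
  square of \<open>proj 0\<close> is known.\<close>

lemma proj_0_square: "(proj 0)\<^sup>2 = (vec_norm f)\<^sup>2"
proof -
  have "(vec_norm f)\<^sup>2 = (\<Sum>k<M. (proj 0)\<^sup>2 * (U $$ (k, 0) * U $$ (k, 0)))"
    unfolding vec_norm_square using f
    by (intro sum.cong) (auto simp: f_eq power2_eq_square)
  also have "\<dots> = (proj 0)\<^sup>2"
    using U_cols[of 0 0] M by (simp flip: sum_distrib_left)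
  finally show ?thesis by simp
qed

lemma proj_0_nz: "proj 0 \<noteq> 0"
proof
  assume "proj 0 = 0"
  then have "f = 0\<^sub>v M"
    using f f_eq by (intro eq_vecI) auto
  with f_nz show False by simp
qed

section \<open>Projected data, DMD matrix and reconstruction\<close>

lemma leading_cols_U: "r \<le> M \<Longrightarrow> leading_cols r U = mat M r (\<lambda>(i, j). U $$ (i, j))"
  using U by (intro eq_matI) (auto simp: leading_cols_def mat_of_cols_def)

lemma dmd_X: "r \<le> M \<Longrightarrow> dmd_X M N r data U = mat r N (\<lambda>(i, j). proj i * c j)"
  by (intro eq_matI)
    (auto simp: dmd_X_def mat_adjoint_real leading_cols_U past scalar_prod_def proj_def
      sum_distrib_right atLeast0LessThan intro!: sum.cong)

lemma dmd_Y: "r \<le> M \<Longrightarrow> dmd_Y M N r data U = mat r N (\<lambda>(i, j). proj i * c (Suc j))"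
  by (intro eq_matI)
    (auto simp: dmd_Y_def mat_adjoint_real leading_cols_U nexts scalar_prod_def proj_def
      sum_distrib_right atLeast0LessThan intro!: sum.cong)

lemma dmd_gram:
  "r \<le> M \<Longrightarrow> dmd_X M N r data U * transpose_mat (dmd_X M N r data U) =
     mat r r (\<lambda>(i, j). proj i * proj j * (\<Sum>k<N. (c k)\<^sup>2))"
  by (intro eq_matI)
    (auto simp: dmd_X scalar_prod_def sum_distrib_left atLeast0LessThan power2_eq_square
      intro!: sum.cong)

lemma dmd_cross:
  "r \<le> M \<Longrightarrow> dmd_Y M N r data U * transpose_mat (dmd_X M N r data U) =
     mat r r (\<lambda>(i, j). proj i * proj j * (\<Sum>k<N. c k * c (Suc k)))"
  by (intro eq_matI)
    (auto simp: dmd_X dmd_Y scalar_prod_def sum_distrib_left atLeast0LessThan power2_eq_square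
      intro!: sum.cong)

definition gram :: real where
  "gram = proj 0 * proj 0 * (\<Sum>k<N. (c k)\<^sup>2)"

lemma gram_nz: "gram \<noteq> 0"
  using proj_0_nz sum_c_pos by (simp add: gram_def)

lemma gram_inverse:
  "mat 1 1 (\<lambda>_. gram) * mat 1 1 (\<lambda>_. 1 / gram) = 1\<^sub>m 1"
  "mat 1 1 (\<lambda>_. 1 / gram) * mat 1 1 (\<lambda>_. gram) = 1\<^sub>m 1"
  using gram_nz by (auto intro!: eq_matI simp: scalar_prod_def)

lemma dmd_gram_1:
  "dmd_X M N 1 data U * transpose_mat (dmd_X M N 1 data U) = mat 1 1 (\<lambda>_. gram)"
  unfolding dmd_gram[OF M] by (intro eq_matI) (auto simp: gram_def)

lemma dmd_exists_1: "dmd_exists M N 1 data U"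
  unfolding dmd_exists_def dmd_gram_1 invertible_mat_def inverts_mat_def
  using M gram_inverse by auto

text \<open>Row 1 of the Gram matrix carries the factor \<open>proj 1 = 0\<close>, so no product
  with it on the left can have the entry 1 at (1, 1).\<close>

lemma not_dmd_exists:
  assumes "1 < r"
  shows "\<not> dmd_exists M N r data U"
proof
  assume ex: "dmd_exists M N r data U"
  then have r: "r \<le> M" by (simp add: dmd_exists_def)
  define G where "G = mat r r (\<lambda>(i, j). proj i * proj j * (\<Sum>k<N. (c k)\<^sup>2))"
  obtain B where B: "G * B = 1\<^sub>m r" "B * G = 1\<^sub>m (dim_row B)"
    using ex by (auto simp: dmd_exists_def dmd_gram[OF r] invertible_mat_def inverts_mat_def G_def)
  \<comment> \<open>The definition of invertibility does not fix the size of \<open>B\<close>; it is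
    read off from the two products.\<close>
  have "dim_col B = r" and "dim_row B = r"
    using arg_cong[OF B(1), of dim_col] arg_cong[OF B(2), of dim_col] by (simp_all add: G_def)
  then have "(G * B) $$ (1, 1) = 0"
    using assms r by (auto simp: G_def scalar_prod_def proj_eq_0)
  with B(1) assms show False by simp
qed

text \<open>The factor \<open>proj 0 * proj 0\<close> cancels between cross term and Gram matrix, so
  the result does not depend on \<open>U\<close>.\<close>

lemma dmd_matrix_1:
  "dmd_matrix M N 1 data U = mat 1 1 (\<lambda>_. (\<Sum>k<N. c k * c (Suc k)) / (\<Sum>k<N. (c k)\<^sup>2))"
proof -
  let ?G = "mat 1 1 (\<lambda>_. gram)"
  have G: "?G \<in> carrier_mat 1 1" by simp
  \<comment> \<open>Being a unit of the matrix ring rules out the result \<open>None\<close> of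
    \<open>mat_inverse\<close>.\<close>
  have "?G \<in> Units (ring_mat TYPE(real) 1 undefined)"
    using gram_inverse by (auto simp: Units_def ring_mat_simps intro!: bexI[of _ "mat 1 1 (\<lambda>_. 1 / gram)"])
  then obtain B where B: "mat_inverse ?G = Some B"
    using mat_inverse(1)[OF G] by fastforce
  note inv = mat_inverse(2)[OF G B]
  then have Bc: "B \<in> carrier_mat 1 1" by simp
  have "(?G * B) $$ (0, 0) = 1"
    using inv by simp
  then have B0: "B $$ (0, 0) = 1 / gram"
    using Bc gram_nz by (simp add: scalar_prod_def field_simps)
  show ?thesis
    unfolding dmd_matrix_def Let_def dmd_gram_1 dmd_cross[OF M] B option.sel
    using Bc B0 sum_c_pos proj_0_nz
    by (intro eq_matI) (auto simp: scalar_prod_def gram_def)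
qed

text \<open>The identity is a good enough competitor for the optimal one-dimensional map.\<close>

lemma dmd_error_le:
  "dmd_error M N 1 data U \<le> (vec_norm f)\<^sup>2 * (\<Sum>k<N. (c (Suc k) - c k)\<^sup>2)"
proof -
  have "dmd_error M N 1 data U \<le> (frobenius_norm (dmd_Y M N 1 data U - 1\<^sub>m 1 * dmd_X M N 1 data U))\<^sup>2"
    unfolding dmd_error_def by (rule cINF_lower) (auto intro!: bdd_belowI[of _ 0])
  also have "\<dots> = (\<Sum>k<N. (proj 0 * c (Suc k) - proj 0 * c k)\<^sup>2)"
    using dmd_X[OF M] dmd_Y[OF M]
    by (simp add: frobenius_norm_def sum_nonneg)
  also have "\<dots> = (proj 0)\<^sup>2 * (\<Sum>k<N. (c (Suc k) - c k)\<^sup>2)"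
    by (simp add: sum_distrib_left power_mult_distrib flip: right_diff_distrib)
  finally show ?thesis
    by (simp add: proj_0_square)
qed

lemma dmd_error_nonneg: "0 \<le> dmd_error M N 1 data U"
  unfolding dmd_error_def by (rule cINF_greatest) (auto intro!: exI[of _ "1\<^sub>m 1"])

text \<open>For a 1 by 1 matrix the eigenvalue is the entry, and the normalized eigenvector is any
  complex number of modulus 1.\<close>

lemma eigensystem_1:
  assumes "eigensystem 1 (dmd_matrix M N 1 data U) \<mu> w"
  shows "\<mu> 0 = of_real ((\<Sum>k<N. c k * c (Suc k)) / (\<Sum>k<N. (c k)\<^sup>2))"
    and "w 0 \<in> carrier_vec 1" and "norm (w 0 $ 0) = 1"
proof -
  let ?m = "(\<Sum>k<N. c k * c (Suc k)) / (\<Sum>k<N. (c k)\<^sup>2)"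
  let ?F = "map_mat complex_of_real (dmd_matrix M N 1 data U)"
  have ev: "eigenvector ?F (w 0) (\<mu> 0)" and n: "vec_norm (w 0) = 1"
    using assms by (auto simp: eigensystem_def)
  show w: "w 0 \<in> carrier_vec 1"
    using ev by (simp add: eigenvector_def dmd_matrix_1 del: One_nat_def)
  then show w0: "norm (w 0 $ 0) = 1"
    using n by (simp add: vec_norm_def L2_set_def)
  have F: "?F = mat 1 1 (\<lambda>_. of_real ?m)"
    unfolding dmd_matrix_1 by (intro eq_matI) auto
  have "(?F *\<^sub>v w 0) $ 0 = (\<mu> 0 \<cdot>\<^sub>v w 0) $ 0"
    using ev by (simp add: eigenvector_def)
  then have "of_real ?m * w 0 $ 0 = \<mu> 0 * w 0 $ 0"
    unfolding F using w by (simp add: scalar_prod_def)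
  then show "\<mu> 0 = of_real ?m"
    using w0 by (subst (asm) mult_right_cancel) auto
qed

text \<open>The coordinate contributes the conjugate of the phase of \<open>w 0\<close> and the mode
  the phase itself, so they cancel. The sign of the singular vector cancels likewise, by
  \<open>f_eq\<close>.\<close>

lemma dmd_reconstruction_1:
  assumes w: "w 0 \<in> carrier_vec 1" "norm (w 0 $ 0) = 1" and j: "j < M"
  shows "dmd_reconstruction M 1 U f w \<mu>t t $ j = of_real (f $ j) * exp (\<mu>t 0 * of_real t)"
proof -
  have ww: "cnj (w 0 $ 0) * w 0 $ 0 = 1"
    using w(2) complex_norm_square[of "w 0 $ 0"] by (simp add: mult.commute)
  have "dmd_coordinate 1 U f (w 0) = of_real (proj 0) * cnj (w 0 $ 0)"
    using w(1) f M leading_cols_U[OF M]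
    by (simp add: dmd_coordinate_def mat_adjoint_real scalar_prod_def proj_def atLeast0LessThan)
  moreover have "dmd_mode 1 U (w 0) $ j = of_real (U $$ (j, 0)) * w 0 $ 0"
    using w(1) j leading_cols_U[OF M]
    by (simp add: dmd_mode_def scalar_prod_def)
  ultimately show ?thesis
    using j ww by (simp add: dmd_reconstruction_def f_eq mult_ac)
qed

end

section \<open>Sampled power profiles\<close>

text \<open>Differentiability is used only in the interior, so \<open>x = 0\<close> is
  allowed.\<close>

lemma powr_mean_value:
  fixes s x y :: real
  assumes "0 < s" and "0 \<le> x" and "x < y"
  obtains z where "x < z" and "z < y" and "y powr s - x powr s = (y - x) * (s * z powr (s - 1))"
proof -
  have deriv: "DERIV (\<lambda>x. x powr s) z :> s * z powr (s - 1)" if "x < z" for z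
    using that assms by (auto intro!: derivative_eq_intros)
  have "continuous_on {x..y} (\<lambda>x. x powr s)"
    using assms by (intro continuous_on_powr' continuous_intros) auto
  then obtain l z where z: "x < z" "z < y" and l: "DERIV (\<lambda>x. x powr s) z :> l"
    and eq: "y powr s - x powr s = (y - x) * l"
    using MVT[OF \<open>x < y\<close>, of "\<lambda>x. x powr s"] deriv by (metis real_differentiable_def)
  show thesis
    using that[OF z] eq DERIV_unique[OF l deriv[OF z(1)]] by simp
qed

lemma powr_diff_le:
  fixes q x y :: real
  assumes "1 \<le> q" and "0 \<le> x" and "x \<le> y" and "y \<le> 1"
  shows "y powr q - x powr q \<le> q * (y - x)"
proof (cases "x = y")
  case False
  then obtain z where z: "x < z" "z < y" and eq: "y powr q - x powr q = (y - x) * (q * z powr (q - 1))"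
    using powr_mean_value[of q x y] assms by auto
  have "z powr (q - 1) \<le> 1"
    using z assms by (intro powr_le1) auto
  then show ?thesis
    unfolding eq using assms by (simp add: mult.commute[of q] mult_left_mono mult_left_le)
qed simp

lemma powr_increment_bounds:
  fixes s :: real and x :: real
  assumes "0 < s" and "0 \<le> x"
  shows "(s + 1) * x powr s \<le> (x + 1) powr (s + 1) - x powr (s + 1)"
    and "(x + 1) powr (s + 1) - x powr (s + 1) \<le> (s + 1) * (x + 1) powr s"
proof -
  obtain z where z: "x < z" "z < x + 1"
    and eq: "(x + 1) powr (s + 1) - x powr (s + 1) = (s + 1) * z powr s"
    using powr_mean_value[of "s + 1" x "x + 1"] assms by auto
  show "(s + 1) * x powr s \<le> (x + 1) powr (s + 1) - x powr (s + 1)"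
    and "(x + 1) powr (s + 1) - x powr (s + 1) \<le> (s + 1) * (x + 1) powr s"
    unfolding eq using z assms by (auto intro!: mult_left_mono powr_mono2)
qed

text \<open>Induction on \<open>n\<close> telescopes the increments of the power s + 1. The upper
  bound uses the increment starting at \<open>Suc n\<close>, hence the shifted argument.\<close>

lemma sum_powr_bounds:
  fixes s :: real
  assumes "0 < s"
  shows "real n powr (s + 1) \<le> (s + 1) * (\<Sum>j<n. real (Suc j) powr s)"
    and "(s + 1) * (\<Sum>j<n. real (Suc j) powr s) \<le> real (Suc n) powr (s + 1)"
proof (induction n)
  case (Suc n)
  case 1
  show ?case
    using Suc(1) powr_increment_bounds(2)[OF assms, of "real n"]
    by (simp add: distrib_left add.commute)
  case 2
  show ?case
    using Suc(2) powr_increment_bounds(1)[OF assms, of "real (Suc n)"]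
    by (simp add: distrib_left add.commute)
qed auto

text \<open>These are Riemann sums of (1 - t)^s on [0, 1]; the previous bounds enclose them
  directly.\<close>

lemma mean_powr_tendsto:
  fixes s :: real
  assumes s: "0 < s"
  shows "(\<lambda>n. (\<Sum>k<n. (1 - real k / real n) powr s) / real n) \<longlonglongrightarrow> 1 / (s + 1)"
proof (rule tendsto_sandwich)
  have eq: "(\<Sum>k<n. (1 - real k / real n) powr s) / real n
      = (\<Sum>j<n. real (Suc j) powr s) / real n powr (s + 1)" if "0 < n" for n
  proof -
    \<comment> \<open>Reversing the summation, k = n - 1 - j, turns the bases into (j + 1) /
      n.\<close>
    have "(\<Sum>k<n. (1 - real k / real n) powr s) = (\<Sum>j<n. (1 - real (n - Suc j) / real n) powr s)"
      by (rule sum.nat_diff_reindex[symmetric])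
    also have "\<dots> = (\<Sum>j<n. real (Suc j) powr s / real n powr s)"
    proof (rule sum.cong[OF refl])
      fix j assume "j \<in> {..<n}"
      then have "1 - real (n - Suc j) / real n = real (Suc j) / real n"
        using that by (simp add: of_nat_diff field_simps)
      then show "(1 - real (n - Suc j) / real n) powr s = real (Suc j) powr s / real n powr s"
        by (simp only: powr_divide of_nat_0_le_iff)
    qed
    finally show ?thesis
      using that by (simp add: powr_add sum_divide_distrib divide_divide_eq_left)
  qed
  show "\<forall>\<^sub>F n in sequentially. 1 / (s + 1) \<le> (\<Sum>k<n. (1 - real k / real n) powr s) / real n"
    using eventually_gt_at_top[of 0]
  proof eventually_elim
    case (elim n)
    then show ?case
      unfolding eq[OF elim] using sum_powr_bounds(1)[OF s, of n] s
      by (simp add: divide_simps mult.commute)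
  qed
  show "\<forall>\<^sub>F n in sequentially. (\<Sum>k<n. (1 - real k / real n) powr s) / real n
      \<le> (1 + 1 / real n) powr (s + 1) / (s + 1)"
    using eventually_gt_at_top[of 0]
  proof eventually_elim
    case (elim n)
    have "(1 + 1 / real n) powr (s + 1) = real (Suc n) powr (s + 1) / real n powr (s + 1)"
      using elim by (subst powr_divide[symmetric]) (auto simp: field_simps)
    then show ?case
      unfolding eq[OF elim] using sum_powr_bounds(2)[OF s, of n] s elim
      by (simp add: divide_simps mult.commute)
  qed
  have "(\<lambda>n. (1 + 1 / real n) powr (s + 1) / (s + 1)) \<longlonglongrightarrow> (1 + 0) powr (s + 1) / (s + 1)"
    using s by (intro tendsto_intros lim_1_over_n) auto
  then show "(\<lambda>n. (1 + 1 / real n) powr (s + 1) / (s + 1)) \<longlonglongrightarrow> 1 / (s + 1)"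
    by simp
qed simp

text \<open>Squeeze by 1 - 1/x \<le> ln x \<le> x - 1; the factor 1/x in the lower bound is harmless
  since x tends to 1.\<close>

lemma n_ln_tendsto:
  fixes x :: "nat \<Rightarrow> real"
  assumes lim: "(\<lambda>n. real n * (x n - 1)) \<longlonglongrightarrow> L"
  shows "x \<longlonglongrightarrow> 1" and "(\<lambda>n. real n * ln (x n)) \<longlonglongrightarrow> L"
proof -
  have "(\<lambda>n. real n * (x n - 1) * (1 / real n)) \<longlonglongrightarrow> L * 0"
    by (intro tendsto_mult lim lim_1_over_n)
  then have "(\<lambda>n. real n * (x n - 1) * (1 / real n)) \<longlonglongrightarrow> 0"
    by simp
  then have "(\<lambda>n. x n - 1) \<longlonglongrightarrow> 0"
    by (rule Lim_transform_eventually) (rule eventually_mono[OF eventually_gt_at_top[of 0]], simp)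
  then show x: "x \<longlonglongrightarrow> 1"
    by (simp add: LIM_zero_iff)
  have pos: "\<forall>\<^sub>F n in sequentially. 0 < x n"
    by (rule order_tendstoD[OF x]) simp
  show "(\<lambda>n. real n * ln (x n)) \<longlonglongrightarrow> L"
  proof (rule tendsto_sandwich)
    show "\<forall>\<^sub>F n in sequentially. real n * (x n - 1) / x n \<le> real n * ln (x n)"
      using pos
    proof eventually_elim
      case (elim n)
      have "- ln (x n) \<le> inverse (x n) - 1"
        using elim ln_le_minus_one[of "inverse (x n)"] by (simp add: ln_inverse)
      then have "(x n - 1) / x n \<le> ln (x n)"
        using elim by (simp add: diff_divide_distrib inverse_eq_divide)
      then show ?case
        by (metis mult_left_mono of_nat_0_le_iff times_divide_eq_right)
    qed
    show "\<forall>\<^sub>F n in sequentially. real n * ln (x n) \<le> real n * (x n - 1)"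
      using pos by eventually_elim (intro mult_left_mono ln_le_minus_one, auto)
    show "(\<lambda>n. real n * (x n - 1) / x n) \<longlonglongrightarrow> L"
      using tendsto_divide[OF lim x] by simp
  qed (rule lim)
qed

section \<open>Asymptotics of the sampled profile and of the DMD eigenvalue\<close>

definition profile :: "real \<Rightarrow> nat \<Rightarrow> nat \<Rightarrow> real" where
  "profile q n k = (max 0 (1 - real k / real n)) powr q"

lemma profile_eq: "k \<le> n \<Longrightarrow> profile q n k = (1 - real k / real n) powr q"
  by (cases "n = 0") (auto simp: profile_def max_def field_simps)

text \<open>This is the discrete eigenvalue itself; the continuous-time rate arises from its
  logarithm divided by the step.\<close>

definition rate :: "real \<Rightarrow> nat \<Rightarrow> real" where
  "rate q n = (\<Sum>k<n. profile q n k * profile q n (Suc k)) / (\<Sum>k<n. (profile q n k)\<^sup>2)"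

text \<open>The sum of squares is at most the largest step, \<open>q / real n\<close>, times the
  total descent, which telescopes to 1.\<close>

lemma profile_steps:
  assumes q: "1 \<le> q" and n: "0 < n"
  shows "(\<Sum>k<n. (profile q n (Suc k) - profile q n k)\<^sup>2) \<le> q / real n"
proof -
  have step: "0 \<le> profile q n k - profile q n (Suc k)"
    "profile q n k - profile q n (Suc k) \<le> q / real n" if "k < n" for k
  proof -
    have "1 - real (Suc k) / real n \<ge> 0" and "1 - real (Suc k) / real n \<le> 1 - real k / real n"
      and "(1 - real k / real n) - (1 - real (Suc k) / real n) = 1 / real n"
      using that n by (auto simp: field_simps)
    then show "0 \<le> profile q n k - profile q n (Suc k)"
      and "profile q n k - profile q n (Suc k) \<le> q / real n"
      using powr_diff_le[OF q, of "1 - real (Suc k) / real n" "1 - real k / real n"] q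
      by (auto simp: profile_eq that Suc_leI less_imp_le intro!: powr_mono2)
  qed
  have "(\<Sum>k<n. (profile q n (Suc k) - profile q n k)\<^sup>2)
      \<le> (\<Sum>k<n. q / real n * (profile q n k - profile q n (Suc k)))"
  proof (rule sum_mono)
    fix k assume "k \<in> {..<n}"
    then show "(profile q n (Suc k) - profile q n k)\<^sup>2
        \<le> q / real n * (profile q n k - profile q n (Suc k))"
      unfolding power2_commute[of "profile q n (Suc k)" "profile q n k"]
      unfolding power2_eq_square using step[of k] by (intro mult_right_mono) auto
  qed
  also have "\<dots> = q / real n * (profile q n 0 - profile q n n)"
    by (simp only: sum_distrib_left[symmetric] sum_lessThan_telescope')
  also have "\<dots> = q / real n"
    using n by (simp add: profile_def)
  finally show ?thesis .
qed

lemma profile_steps_tendsto: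
  assumes q: "1 \<le> q"
  shows "(\<lambda>n. \<Sum>k<n. (profile q n (Suc k) - profile q n k)\<^sup>2) \<longlonglongrightarrow> 0"
proof (rule tendsto_sandwich[of "\<lambda>_. 0" _ _ "\<lambda>n. q / real n"])
  show "\<forall>\<^sub>F n in sequentially. (\<Sum>k<n. (profile q n (Suc k) - profile q n k)\<^sup>2) \<le> q / real n"
    by (rule eventually_mono[OF eventually_gt_at_top[of 0]]) (rule profile_steps[OF q])
qed (auto intro!: always_eventually sum_nonneg lim_const_over_n)

text \<open>
  Summation by parts: since the profile falls from 1 to 0,
  the sum of a(k) * (a(k) - a(k+1)) is half of 1 plus the sum of the squared steps.
\<close>

lemma n_rate_tendsto:
  assumes q: "1 \<le> q"
  shows "(\<lambda>n. real n * (rate q n - 1)) \<longlonglongrightarrow> - (2 * q + 1) / 2"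
proof -
  define D where "D n = (\<Sum>k<n. (profile q n (Suc k) - profile q n k)\<^sup>2)" for n
  define E where "E n = (\<Sum>k<n. (1 - real k / real n) powr (2 * q)) / real n" for n
  have E: "E \<longlonglongrightarrow> 1 / (2 * q + 1)"
    unfolding E_def using q by (intro mean_powr_tendsto) simp
  \<comment> \<open>\<open>D\<close> is the sum of squared steps and \<open>E\<close> the mean
    square of the samples; \<open>n * (rate q n - 1)\<close> is shown below to equal this
    quotient.\<close>
  have "(\<lambda>n. - (1 + D n) / 2 / E n) \<longlonglongrightarrow> - (1 + 0) / 2 / (1 / (2 * q + 1))"
    unfolding D_def using q by (intro tendsto_intros E profile_steps_tendsto) auto
  also have "- (1 + 0) / 2 / (1 / (2 * q + 1)) = - (2 * q + 1) / 2"
    by (simp only: add_0_right divide_divide_eq_right mult_minus1 minus_divide_left)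
  finally have "(\<lambda>n. - (1 + D n) / 2 / E n) \<longlonglongrightarrow> - (2 * q + 1) / 2" .
  then show ?thesis
  proof (rule Lim_transform_eventually)
    show "\<forall>\<^sub>F n in sequentially. - (1 + D n) / 2 / E n = real n * (rate q n - 1)"
      using eventually_gt_at_top[of 0]
    proof eventually_elim
      case (elim n)
      define A where "A = (\<Sum>k<n. (profile q n k)\<^sup>2)"
      have "A = (\<Sum>k<n. (1 - real k / real n) powr (2 * q))"
        unfolding A_def
        by (intro sum.cong) (auto simp: profile_eq power2_eq_square simp flip: powr_add)
      then have E: "E n = A / real n"
        by (simp add: E_def)
      have A: "0 < A"
        unfolding A_def using elim by (intro sum_pos2[of _ 0]) (auto simp: profile_def)
      \<comment> \<open>The identity ab = a^2 - (a^2 - b^2)/2 - (b - a)^2/2 isolates a telescoping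
        part.\<close>
      have "(\<Sum>k<n. profile q n k * profile q n (Suc k))
          = (\<Sum>k<n. (profile q n k)\<^sup>2 - ((profile q n k)\<^sup>2 - (profile q n (Suc k))\<^sup>2) / 2
              - (profile q n (Suc k) - profile q n k)\<^sup>2 / 2)"
        by (intro sum.cong) (auto simp: power2_eq_square field_simps)
      also have "\<dots> = A - (\<Sum>k<n. (profile q n k)\<^sup>2 - (profile q n (Suc k))\<^sup>2) / 2 - D n / 2"
        by (simp add: sum_subtractf A_def D_def flip: sum_divide_distrib)
      also have "(\<Sum>k<n. (profile q n k)\<^sup>2 - (profile q n (Suc k))\<^sup>2) = (profile q n 0)\<^sup>2 - (profile q n n)\<^sup>2"
        by (rule sum_lessThan_telescope')
      also have "\<dots> = 1"
        using elim by (simp add: profile_def)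
      finally have "(\<Sum>k<n. profile q n k * profile q n (Suc k)) = A - 1 / 2 - D n / 2" .
      then have "rate q n - 1 = - (1 + D n) / 2 / A"
        unfolding rate_def A_def[symmetric] using A by (simp add: diff_divide_distrib add_divide_distrib)
      then show ?case
        unfolding E by simp
    qed
  qed
qed

text \<open>Reverse triangle inequality in L^2. The integrand dominates (1 - H/G) g^2 + (1 - G/H)
  h^2, with difference (H g - G h)^2 / (G H), and this minorant integrates to (G - H)^2.\<close>

lemma integral_square_diff_ge:
  fixes g h :: "real \<Rightarrow> real"
  assumes g: "continuous_on {a..b} g" and h: "continuous_on {a..b} h"
    and G: "integral {a..b} (\<lambda>t. (g t)\<^sup>2) = G\<^sup>2" and H: "integral {a..b} (\<lambda>t. (h t)\<^sup>2) = H\<^sup>2"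
    and "0 < G" and "0 < H"
  shows "(G - H)\<^sup>2 \<le> integral {a..b} (\<lambda>t. (g t - h t)\<^sup>2)"
proof -
  have gi: "(\<lambda>t. (g t)\<^sup>2) integrable_on {a..b}" and hi: "(\<lambda>t. (h t)\<^sup>2) integrable_on {a..b}"
    using g h by (auto intro!: integrable_continuous_real continuous_intros)
  have "(G - H)\<^sup>2 = (1 - H / G) * G\<^sup>2 + (1 - G / H) * H\<^sup>2"
    using assms by (simp add: power2_eq_square field_simps)
  also have "\<dots> = integral {a..b} (\<lambda>t. (1 - H / G) * (g t)\<^sup>2 + (1 - G / H) * (h t)\<^sup>2)"
    using gi hi by (subst Henstock_Kurzweil_Integration.integral_add)
      (auto simp: G H intro!: integrable_on_mult_right)
  also have "\<dots> \<le> integral {a..b} (\<lambda>t. (g t - h t)\<^sup>2)"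
  proof (rule integral_le)
    fix t
    have "(g t - h t)\<^sup>2 - ((1 - H / G) * (g t)\<^sup>2 + (1 - G / H) * (h t)\<^sup>2)
        = (H * g t - G * h t)\<^sup>2 / (G * H)"
      using assms by (simp add: power2_eq_square field_simps)
    also have "\<dots> \<ge> 0"
      using assms by simp
    finally show "(1 - H / G) * (g t)\<^sup>2 + (1 - G / H) * (h t)\<^sup>2 \<le> (g t - h t)\<^sup>2"
      by simp
  qed (use g h in \<open>auto intro!: integrable_continuous_real continuous_intros\<close>)
  finally show ?thesis .
qed

section \<open>The decay profile and its exponential reconstruction\<close>

context
  fixes p lam :: real
  assumes p: "1 \<le> p" "p < 2" and lam: "lam < 0"
begin

private abbreviation (input) "q \<equiv> 1 / (2 - p)"
private abbreviation (input) "T \<equiv> extinction_time p lam"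
private abbreviation (input) "limit_rate \<equiv> lam * (4 - p) / 2"
text \<open>The squared L^2 norm of the decay profile on [0, T], as
  \<open>integral_decay_profile\<close> shows.\<close>

private abbreviation (input) "energy \<equiv> - 1 / (lam * (4 - p))"

lemma T_pos: "0 < T"
  using p lam by (simp add: extinction_time_def divide_pos_neg mult_less_0_iff)

lemma T_eq: "T * (2 - p) = - 1 / lam"
  using p by (simp add: extinction_time_def)

lemma exponent_eq: "2 * q + 1 = (4 - p) / (2 - p)"
  using p by (simp add: field_simps)

lemma energy_pos: "0 < energy"
  using p lam by (simp add: mult_less_0_iff divide_neg_neg)

lemma decay_profile_eq: "decay_profile p lam t = (max 0 (1 - t / T)) powr q"
  using p lam by (simp add: decay_profile_def extinction_time_def mult_ac)

lemma decay_profile_sample: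
  "0 < N \<Longrightarrow> decay_profile p lam (real k * sampling_step p lam N) = profile q N k"
  using T_pos by (simp add: decay_profile_eq sampling_step_def profile_def)

lemma continuous_decay_profile: "continuous_on X (decay_profile p lam)"
  unfolding decay_profile_eq[abs_def] using p T_pos
  by (intro continuous_on_powr' continuous_intros) auto

lemma integral_decay_profile: "integral {0..T} (\<lambda>t. (decay_profile p lam t)\<^sup>2) = energy"
proof -
  let ?s = "2 * q + 1"
  let ?G = "\<lambda>t. - T / ?s * (1 - t / T) powr ?s"
  have s: "0 < ?s"
    using p by (simp add: add_pos_pos)
  have "((\<lambda>t. (decay_profile p lam t)\<^sup>2) has_integral (?G T - ?G 0)) {0..T}"
  \<comment> \<open>The antiderivative is differentiated only for t < T, where the base of
    \<open>powr\<close> is positive.\<close>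
  proof (rule fundamental_theorem_of_calculus_interior)
    show "continuous_on {0..T} ?G"
      using s T_pos by (intro continuous_on_powr' continuous_intros) auto
    fix t assume t: "t \<in> {0<..<T}"
    have "(?G has_real_derivative (1 - t / T) powr (2 * q)) (at t)"
      using t s T_pos by (auto intro!: derivative_eq_intros)
    moreover have "(1 - t / T) powr (2 * q) = (decay_profile p lam t)\<^sup>2"
      using t by (simp add: decay_profile_eq power2_eq_square max_def flip: powr_add)
    ultimately show "(?G has_vector_derivative (decay_profile p lam t)\<^sup>2) (at t)"
      by (simp add: has_real_derivative_iff_has_vector_derivative)
  qed (use T_pos in simp)
  then have "integral {0..T} (\<lambda>t. (decay_profile p lam t)\<^sup>2) = T / ?s"
    using T_pos s by (simp add: integral_unique)
  also have "\<dots> = T * (2 - p) / (4 - p)"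
    by (simp only: exponent_eq divide_divide_eq_right)
  also have "\<dots> = energy"
    unfolding T_eq by simp
  finally show ?thesis .
qed

text \<open>The squared exponential has rate \<open>lam * (4 - p)\<close>, whose product with T is
  the exponent appearing in the bound.\<close>

lemma integral_exp_limit_rate:
  "integral {0..T} (\<lambda>t. (exp (limit_rate * t))\<^sup>2) = energy * (1 - exp (- ((4 - p) / (2 - p))))"
proof -
  let ?c = "lam * (4 - p)"
  have c: "?c \<noteq> 0" using p lam by simp
  have "((\<lambda>t. (exp (limit_rate * t))\<^sup>2) has_integral (exp (?c * T) / ?c - exp (?c * 0) / ?c)) {0..T}"
  proof (rule fundamental_theorem_of_calculus)
    fix t
    have "((\<lambda>t. exp (?c * t) / ?c) has_real_derivative exp (?c * t)) (at t within {0..T})"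
      using c by (auto intro!: derivative_eq_intros)
    then show "((\<lambda>t. exp (?c * t) / ?c) has_vector_derivative (exp (limit_rate * t))\<^sup>2) (at t within {0..T})"
      by (simp add: has_real_derivative_iff_has_vector_derivative flip: exp_double)
  qed (use T_pos in simp)
  moreover have "?c * T = - ((4 - p) / (2 - p))"
    using lam by (simp add: extinction_time_def)
  ultimately show ?thesis
    using c by (simp add: integral_unique diff_divide_distrib right_diff_distrib)
qed

text \<open>Dividing by the step T/N means multiplying by N/T, so the rate is -(2q +
  1)/(2T).\<close>

lemma limit_rate_tendsto:
  "(\<lambda>N. Ln (of_real (rate q N)) / of_real (sampling_step p lam N)) \<longlonglongrightarrow> of_real limit_rate"
proof -
  have q: "1 \<le> q" using p by simp
  note lim = n_ln_tendsto[OF n_rate_tendsto[OF q]]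
  have "(\<lambda>N. real N * ln (rate q N) / T) \<longlonglongrightarrow> - (2 * q + 1) / 2 / T"
    using T_pos by (intro tendsto_divide lim tendsto_const) auto
  also have "- (2 * q + 1) / 2 / T = limit_rate"
  proof -
    have "- (2 * q + 1) / 2 / T = - ((4 - p) / (2 * (T * (2 - p))))"
      unfolding exponent_eq by (simp add: mult_ac)
    then show ?thesis
      unfolding T_eq by simp
  qed
  finally have "(\<lambda>N. complex_of_real (real N * ln (rate q N) / T)) \<longlonglongrightarrow> of_real limit_rate"
    by (rule tendsto_of_real)
  moreover have "\<forall>\<^sub>F N in sequentially. 0 < rate q N"
    by (rule order_tendstoD[OF lim(1)]) simp
  \<comment> \<open>Positivity of the eigenvalue lets the complex logarithm agree with the real
    one.\<close>
  then have "\<forall>\<^sub>F N in sequentially. complex_of_real (real N * ln (rate q N) / T)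
      = Ln (of_real (rate q N)) / of_real (sampling_step p lam N)"
    by eventually_elim (simp add: Ln_of_real sampling_step_def)
  ultimately show ?thesis
    by (rule Lim_transform_eventually)
qed

text \<open>Exhibits the bound as a squared difference of the two L^2 norms, ready for the reverse
  triangle inequality.\<close>

lemma error_bound_eq:
  "error_bound p lam f =
     (vec_norm f)\<^sup>2 * (sqrt (energy * (1 - exp (- ((4 - p) / (2 - p))))) - sqrt energy)\<^sup>2"
proof -
  have "(sqrt (energy * x) - sqrt energy)\<^sup>2 = energy * (1 - sqrt x)\<^sup>2" for x
  proof -
    have "(sqrt (energy * x) - sqrt energy)\<^sup>2 = (sqrt energy)\<^sup>2 * (1 - sqrt x)\<^sup>2"
      unfolding real_sqrt_mult by (simp only: power2_eq_square) (simp only: algebra_simps)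
    then show ?thesis
      using energy_pos by simp
  qed
  then show ?thesis
    by (simp add: error_bound_def)
qed

lemma error_bound_pos:
  assumes "f \<in> carrier_vec M" and "f \<noteq> 0\<^sub>v M"
  shows "0 < error_bound p lam f"
proof -
  have "(vec_norm f)\<^sup>2 \<noteq> 0"
  proof
    assume "(vec_norm f)\<^sup>2 = 0"
    then have "f = 0\<^sub>v M"
      using assms(1) by (intro eq_vecI) (auto simp: vec_norm_square sum_nonneg_eq_0_iff)
    with assms show False by simp
  qed
  moreover have "sqrt (1 - exp (- ((4 - p) / (2 - p)))) \<noteq> 1"
    by simp
  moreover have "error_bound p lam f =
      (vec_norm f)\<^sup>2 * (energy * (1 - sqrt (1 - exp (- ((4 - p) / (2 - p)))))\<^sup>2)"
    by (simp add: error_bound_def)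
  ultimately show ?thesis
    using energy_pos by (simp only: zero_less_mult_iff) simp
qed

text \<open>Both curves are scalar multiples of \<open>f\<close>, so its norm factors out and a
  comparison of two scalar functions remains.\<close>

lemma reconstruction_error_ge:
  assumes f: "f \<in> carrier_vec M"
    and \<psi>: "\<And>t. 0 \<le> t \<Longrightarrow> \<psi> t = decay_profile p lam t \<cdot>\<^sub>v f"
    and \<psi>r: "\<And>t. \<psi>r t \<in> carrier_vec M"
      "\<And>t j. j < M \<Longrightarrow> \<psi>r t $ j = of_real (f $ j) * exp (of_real limit_rate * of_real t)"
  shows "error_bound p lam f \<le> reconstruction_error T \<psi>r \<psi>"
proof -
  let ?x = "1 - exp (- ((4 - p) / (2 - p)))"
  have x: "0 < energy * ?x"
    using energy_pos p by (intro mult_pos_pos) auto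
  have pointwise: "(vec_norm (\<psi>r t - map_vec complex_of_real (\<psi> t)))\<^sup>2
      = (vec_norm f)\<^sup>2 * (exp (limit_rate * t) - decay_profile p lam t)\<^sup>2" if "0 \<le> t" for t
  proof -
    have "norm ((\<psi>r t - map_vec complex_of_real (\<psi> t)) $ j)
        = \<bar>f $ j * (exp (limit_rate * t) - decay_profile p lam t)\<bar>" if "j < M" for j
    proof -
      have "(\<psi>r t - map_vec complex_of_real (\<psi> t)) $ j
          = of_real (f $ j * (exp (limit_rate * t) - decay_profile p lam t))"
        using that f \<psi>[OF \<open>0 \<le> t\<close>]
        by (simp add: \<psi>r(2)[OF that, unfolded of_real_mult[symmetric] exp_of_real] right_diff_distrib
            mult.commute del: of_real_mult flip: of_real_mult of_real_diff)
      then show ?thesis by (simp only: norm_of_real)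
    qed
    then show ?thesis
      using f \<psi>[OF that] by (simp add: vec_norm_square sum_distrib_right power_mult_distrib)
  qed
  have "error_bound p lam f \<le>
      (vec_norm f)\<^sup>2 * integral {0..T} (\<lambda>t. (exp (limit_rate * t) - decay_profile p lam t)\<^sup>2)"
    unfolding error_bound_eq
  proof (intro mult_left_mono integral_square_diff_ge continuous_decay_profile)
    show "integral {0..T} (\<lambda>t. (exp (limit_rate * t))\<^sup>2) = (sqrt (energy * ?x))\<^sup>2"
      unfolding integral_exp_limit_rate using x by (intro real_sqrt_pow2[symmetric]) linarith
    show "integral {0..T} (\<lambda>t. (decay_profile p lam t)\<^sup>2) = (sqrt energy)\<^sup>2"
      unfolding integral_decay_profile using energy_pos by (intro real_sqrt_pow2[symmetric]) linarith
  qed (use energy_pos x in \<open>auto intro!: continuous_intros simp del: times_divide_eq_left\<close>)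
  also have "\<dots> = integral {0..T} (\<lambda>t. (vec_norm f)\<^sup>2 * (exp (limit_rate * t) - decay_profile p lam t)\<^sup>2)"
    by simp
  also have "\<dots> = reconstruction_error T \<psi>r \<psi>"
    unfolding reconstruction_error_def
    by (intro Henstock_Kurzweil_Integration.integral_cong) (simp add: pointwise)
  finally show ?thesis .
qed

end

section \<open>DMD of the sampled flow\<close>

theorem theorem1:
  fixes M :: nat and p lam :: real
    and R :: "real vec \<Rightarrow> real" and P :: "real vec \<Rightarrow> real vec set"
    and f :: "real vec" and \<psi> :: "real \<Rightarrow> real vec"
  assumes "1 \<le> p" and "p < 2"
    and "\<forall>v\<in>carrier_vec M. 0 \<le> R v"
    and "abs_homogeneous M p R"
    and "\<forall>v\<in>carrier_vec M. P v = uminus ` subdifferential M R v"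
    and "homogeneous_operator M p P"
    and "maximally_monotone M (\<lambda>v. uminus ` P v)"
    and "f \<in> carrier_vec M" and "f \<noteq> 0\<^sub>v M"
    and "lam \<cdot>\<^sub>v f \<in> P f" and "lam < 0"
    and "\<forall>t\<ge>0. \<psi> t = decay_profile p lam t \<cdot>\<^sub>v f"
    and "flow_solution M P f \<psi>"
  shows
    "(\<forall>U S V \<mu> w.
        (\<forall>N\<ge>1. is_svd (past_snapshots M N (samples p lam \<psi> N)) (U N) (S N) (V N)) \<longrightarrow>
        (\<forall>N\<ge>1. dmd_exists M N 1 (samples p lam \<psi> N) (U N)) \<and>
        (\<lambda>N. dmd_error M N 1 (samples p lam \<psi> N) (U N)) \<longlonglongrightarrow> 0 \<and>
        ((\<forall>N\<ge>1. eigensystem 1 (dmd_matrix M N 1 (samples p lam \<psi> N) (U N)) (\<mu> N) (w N)) \<longrightarrow>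
          (\<exists>\<psi>r. dmd_limit_reconstruction M 1 (sampling_step p lam) U (\<psi> 0) w \<mu> \<psi>r) \<and>
          (\<forall>\<psi>r. dmd_limit_reconstruction M 1 (sampling_step p lam) U (\<psi> 0) w \<mu> \<psi>r \<longrightarrow>
             error_bound p lam f \<le> reconstruction_error (extinction_time p lam) \<psi>r \<psi>)))
     \<and> 0 < error_bound p lam f
     \<and> (\<forall>r>1. \<forall>N\<ge>1. \<forall>U S V.
          is_svd (past_snapshots M N (samples p lam \<psi> N)) U S V \<longrightarrow>
          \<not> dmd_exists M N r (samples p lam \<psi> N) U)"
proof -
  note p = assms(1,2) and f = assms(8) and f_nz = assms(9) and lam = assms(11) and \<psi> = assms(12)
  let ?q = "1 / (2 - p)"
  let ?c = "lam * (4 - p) / 2"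
  have q: "1 \<le> ?q" using p by simp
  have \<psi>0: "\<psi> 0 = f"
    using \<psi> by (simp add: decay_profile_def)
  \<comment> \<open>An equality of whole sequences: beyond extinction, k > N, the positive part
    makes both sides zero.\<close>
  have samples: "samples p lam \<psi> N = (\<lambda>k. profile ?q N k \<cdot>\<^sub>v f)" if "1 \<le> N" for N
  proof
    fix k
    have "0 \<le> real k * sampling_step p lam N"
      using T_pos[OF p lam] by (simp add: sampling_step_def)
    then show "samples p lam \<psi> N k = profile ?q N k \<cdot>\<^sub>v f"
      using \<psi> that by (simp add: samples_def decay_profile_sample[OF p lam])
  qed
  have rank_one: "rank_one_dmd M N f (profile ?q N) U S V"
    if "1 \<le> N" and "is_svd (past_snapshots M N (samples p lam \<psi> N)) U S V" for N U S V
    using that f f_nz unfolding samples[OF that(1)]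
    by unfold_locales (auto simp: profile_def)
  show ?thesis
  proof (intro conjI allI impI)
    fix U S V :: "nat \<Rightarrow> real mat" and \<mu> :: "nat \<Rightarrow> nat \<Rightarrow> complex" and w :: "nat \<Rightarrow> nat \<Rightarrow> complex vec"
    assume svd: "\<forall>N\<ge>1. is_svd (past_snapshots M N (samples p lam \<psi> N)) (U N) (S N) (V N)"
    have dmd: "rank_one_dmd M N f (profile ?q N) (U N) (S N) (V N)" if "1 \<le> N" for N
      using rank_one[OF that] svd that by blast
    show "dmd_exists M N 1 (samples p lam \<psi> N) (U N)" if "1 \<le> N" for N
      unfolding samples[OF that] by (rule rank_one_dmd.dmd_exists_1[OF dmd[OF that]])
    show "(\<lambda>N. dmd_error M N 1 (samples p lam \<psi> N) (U N)) \<longlonglongrightarrow> 0"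
    proof (rule tendsto_sandwich)
      show "\<forall>\<^sub>F N in sequentially. 0 \<le> dmd_error M N 1 (samples p lam \<psi> N) (U N)"
        using eventually_ge_at_top[of 1]
        by eventually_elim (simp only: samples rank_one_dmd.dmd_error_nonneg[OF dmd])
      show "\<forall>\<^sub>F N in sequentially. dmd_error M N 1 (samples p lam \<psi> N) (U N)
          \<le> (vec_norm f)\<^sup>2 * (\<Sum>k<N. (profile ?q N (Suc k) - profile ?q N k)\<^sup>2)"
        using eventually_ge_at_top[of 1]
        by eventually_elim (simp only: samples rank_one_dmd.dmd_error_le[OF dmd])
      show "(\<lambda>N. (vec_norm f)\<^sup>2 * (\<Sum>k<N. (profile ?q N (Suc k) - profile ?q N k)\<^sup>2)) \<longlonglongrightarrow> 0"
        by (rule tendsto_mult_right_zero[OF profile_steps_tendsto[OF q]])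
    qed simp
    assume ev: "\<forall>N\<ge>1. eigensystem 1 (dmd_matrix M N 1 (samples p lam \<psi> N) (U N)) (\<mu> N) (w N)"
    have eig: "\<mu> N 0 = of_real (rate ?q N)" "w N 0 \<in> carrier_vec 1" "norm (w N 0 $ 0) = 1"
      if "1 \<le> N" for N
      using rank_one_dmd.eigensystem_1[OF dmd[OF that], of "\<mu> N" "w N"] ev that
      by (auto simp: samples rate_def)
    have rates: "(\<lambda>N. Ln (\<mu> N 0) / of_real (sampling_step p lam N)) \<longlonglongrightarrow> of_real ?c"
      by (rule Lim_transform_eventually[OF limit_rate_tendsto[OF p lam]])
        (use eventually_ge_at_top[of 1] in eventually_elim, simp add: eig)
    \<comment> \<open>For fixed \<open>\<mu>t\<close> the reconstruction is the same for all
      \<open>N \<ge> 1\<close>, whatever \<open>U N\<close> and \<open>w N\<close> are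
      chosen.\<close>
    have recon: "(\<lambda>N. dmd_reconstruction M 1 (U N) (\<psi> 0) (w N) \<mu>t t $ j)
        \<longlonglongrightarrow> of_real (f $ j) * exp (\<mu>t 0 * of_real t)" if "j < M" for \<mu>t t j
      by (rule tendsto_eventually)
        (use eventually_ge_at_top[of 1] in eventually_elim,
          use rank_one_dmd.dmd_reconstruction_1[OF dmd] eig(2,3) that in \<open>simp only: \<psi>0\<close>)
    show "\<exists>\<psi>r. dmd_limit_reconstruction M 1 (sampling_step p lam) U (\<psi> 0) w \<mu> \<psi>r"
      unfolding dmd_limit_reconstruction_def
      by (rule exI[of _ "\<lambda>t. vec M (\<lambda>j. of_real (f $ j) * exp (of_real ?c * of_real t))"],
          rule exI[of _ "\<lambda>_. of_real ?c"])
        (use rates recon[of _ "\<lambda>_. of_real ?c"] in auto)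
    fix \<psi>r
    assume "dmd_limit_reconstruction M 1 (sampling_step p lam) U (\<psi> 0) w \<mu> \<psi>r"
    then obtain \<mu>t where \<mu>t: "(\<lambda>N. Ln (\<mu> N 0) / of_real (sampling_step p lam N)) \<longlonglongrightarrow> \<mu>t 0"
      and \<psi>r: "\<And>t. \<psi>r t \<in> carrier_vec M"
        "\<And>t j. j < M \<Longrightarrow> (\<lambda>N. dmd_reconstruction M 1 (U N) (\<psi> 0) (w N) \<mu>t t $ j) \<longlonglongrightarrow> \<psi>r t $ j"
      unfolding dmd_limit_reconstruction_def by auto
    \<comment> \<open>Uniqueness of limits pins down the rate, and below the curve
      \<open>\<psi>r\<close> as well.\<close>
    have c: "\<mu>t 0 = of_real ?c"
      by (rule LIMSEQ_unique[OF \<mu>t rates])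
    show "error_bound p lam f \<le> reconstruction_error (extinction_time p lam) \<psi>r \<psi>"
    proof (rule reconstruction_error_ge[OF p lam f _ \<psi>r(1)])
      show "\<psi>r t $ j = of_real (f $ j) * exp (of_real ?c * of_real t)" if "j < M" for t j
        using LIMSEQ_unique[OF \<psi>r(2)[OF that] recon[OF that]] by (simp only: c)
    qed (use \<psi> in simp)
  next
    show "0 < error_bound p lam f"
      by (rule error_bound_pos[OF p lam f f_nz])
  next
    fix r N :: nat and U S V
    assume "1 < r" and N: "1 \<le> N" and "is_svd (past_snapshots M N (samples p lam \<psi> N)) U S V"
    then show "\<not> dmd_exists M N r (samples p lam \<psi> N) U"
      unfolding samples[OF N]
      using rank_one_dmd.not_dmd_exists rank_one samples by metis
  qed
qed

end
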